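(* Fix a real number $\rho>0$. The map $\mathcal{I}_{PS}:\mathbb{RP}^2_P\to\mathbb{RP}^2_S$ from the extended Euclidean plane to the hemisphere construction of radius $\rho$ is an isomorphism; that is, it is a bijection from the points of $\mathbb{RP}^2_P$ to the points of $\mathbb{RP}^2_S$ that preserves line structure: for every line $\ell\subset\mathbb{RP}^2_P$, the image set $\{\mathcal{I}_{PS}(p)\mid p\in\ell\}$ is a line in $\mathbb{RP}^2_S$.
   Context: Extended Euclidean plane: $\mathbb{RP}^2_P=\mathbb{R}^2\cup\ell_{\infty,P}$, where $\ell_{\infty,P}=\{(m)\mid m\in\mathbb{R}\cup\{\infty\}\}$ is a set of additional formal points, one for each slope $m\in\mathbb{R}\cup\{\infty\}$, disjoint from $\mathbb{R}^2$. Its lines are: the sets $\{(x,mx+b)\mid x\in\mathbb{R}\}\cup\{(m)\}$ for $m,b\in\mathbb{R}$; the vertical lines $\{(c,y)\mid y\in\mathbb{R}\}\cup\{(\infty)\}$ for $c\in\mathbb{R}$; and the line at infinity $\ell_{\infty,P}$. Hemisphere construction of radius $\rho>0$: spherical coordinates $(\rho,\theta,\phi)$ denote the point $(\rho\sin\phi\cos\theta,\rho\sin\phi\sin\theta,\rho\cos\phi)\in\mathbb{R}^3$. Let $H=\{s\in\mathbb{R}^3\mid \|s\|=\rho,\ s_3>0\}$ and let $\ell_{\infty,S}=\{s\in\mathbb{R}^3\mid \|s\|=\rho,\ s_3=0,\ \text{azimuthal angle }\theta\in(-\pi/2,\pi/2]\}$ (half of the equator, containing exactly one of each pair of antipodal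 points). Then $\mathbb{RP}^2_S=H\cup\ell_{\infty,S}$. Its lines are the great semicircles, i.e. the sets $\Pi\cap\mathbb{RP}^2_S$ where $\Pi$ is a 2-dimensional linear subspace of $\mathbb{R}^3$; in particular $\ell_{\infty,S}$ is a line. The map $\mathcal{I}_{PS}$: for $(x,y)\in\mathbb{R}^2$, $\mathcal{I}_{PS}((x,y))=(\rho,\theta,\phi)$ in spherical coordinates, where $\phi=\tan^{-1}\sqrt{x^2+y^2}$ and $\theta=\tan^{-1}(y/x)$ if $x>0$, $\theta=\tan^{-1}(y/x)+\pi$ if $x<0$, $\theta=\pi/2$ if $x=0$ and $y\ge 0$, $\theta=-\pi/2$ if $x=0$ and $y<0$ (equivalently, a point with polar coordinates $(r,\alpha)$ is sent to $(\rho,\alpha,\tan^{-1}r)$). For $m\in\mathbb{R}$, $\mathcal{I}_{PS}((m))=(\rho,\tan^{-1}m,\pi/2)$, and $\mathcal{I}_{PS}((\infty))=(\rho,\pi/2,\pi/2)$. *)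

theory Defs
  imports "HOL-Analysis.Analysis"
begin

datatype slope = Finite_Slope real | Vertical_Slope

datatype ext_point = Affine "real \<times> real" | Ideal slope

definition line_at_infinity_P :: "ext_point set" where
  "line_at_infinity_P = range Ideal"

text \<open>By construction this is the whole type; it is spelled out to mirror the definition
  of the extended plane as a union.\<close>

definition RP2_P :: "ext_point set" where
  "RP2_P = range Affine \<union> line_at_infinity_P"

definition sloped_line :: "real \<Rightarrow> real \<Rightarrow> ext_point set" where
  "sloped_line m b = {Affine (x, m * x + b) | x. True} \<union> {Ideal (Finite_Slope m)}"

definition vertical_line :: "real \<Rightarrow> ext_point set" where
  "vertical_line c = {Affine (c, y) | y. True} \<union> {Ideal Vertical_Slope}"

definition lines_P :: "ext_point set set" where
  "lines_P = {sloped_line m b | m b. True} \<union> {vertical_line c | c. True} \<union> {line_at_infinity_P}"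

text \<open>Arguments: radius, azimuthal angle, polar angle measured from the positive third axis.\<close>

definition spherical :: "real \<Rightarrow> real \<Rightarrow> real \<Rightarrow> real ^ 3" where
  "spherical \<rho> \<theta> \<phi> =
     vector [\<rho> * sin \<phi> * cos \<theta>, \<rho> * sin \<phi> * sin \<theta>, \<rho> * cos \<phi>]"

definition open_hemisphere :: "real \<Rightarrow> (real ^ 3) set" where
  "open_hemisphere \<rho> = {s. norm s = \<rho> \<and> s $ 3 > 0}"

definition line_at_infinity_S :: "real \<Rightarrow> (real ^ 3) set" where
  "line_at_infinity_S \<rho> =
     {s. norm s = \<rho> \<and> s $ 3 = 0 \<and> (\<exists>\<theta>\<in>{- pi / 2<..pi / 2}. s = spherical \<rho> \<theta> (pi / 2))}"

definition RP2_S :: "real \<Rightarrow> (real ^ 3) set" where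
  "RP2_S \<rho> = open_hemisphere \<rho> \<union> line_at_infinity_S \<rho>"

definition lines_S :: "real \<Rightarrow> (real ^ 3) set set" where
  "lines_S \<rho> = {W \<inter> RP2_S \<rho> | W. subspace W \<and> dim W = 2}"

definition azimuth :: "real \<Rightarrow> real \<Rightarrow> real" where
  "azimuth x y =
     (if x > 0 then arctan (y / x)
      else if x < 0 then arctan (y / x) + pi
      else if y \<ge> 0 then pi / 2
      else - pi / 2)"

fun I_PS :: "real \<Rightarrow> ext_point \<Rightarrow> real ^ 3" where
  "I_PS \<rho> (Affine (x, y)) = spherical \<rho> (azimuth x y) (arctan (sqrt (x\<^sup>2 + y\<^sup>2)))"
| "I_PS \<rho> (Ideal (Finite_Slope m)) = spherical \<rho> (arctan m) (pi / 2)"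
| "I_PS \<rho> (Ideal Vertical_Slope) = spherical \<rho> (pi / 2) (pi / 2)"

end

theory Submission
  imports Defs
begin

text \<open>Give every point of the extended plane homogeneous coordinates: \<open>(x, y, 1)\<close> for an affine
  point, \<open>(1, m, 0)\<close> and \<open>(0, 1, 0)\<close> for the ideal ones. The map \<open>I_PS \<rho>\<close> is the radial projection of
  this vector to the sphere of radius \<open>\<rho>\<close>. Every line of the extended plane is the set of
  points whose homogeneous coordinates are orthogonal to some fixed nonzero vector \<open>n\<close>, and
  orthogonality is not affected by rescaling, so the image of the line is cut out on the hemisphere
  by the plane orthogonal to \<open>n\<close>.\<close>

fun homogeneous :: "ext_point \<Rightarrow> real ^ 3" where
  "homogeneous (Affine (x, y)) = vector [x, y, 1]"
| "homogeneous (Ideal (Finite_Slope m)) = vector [1, m, 0]"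
| "homogeneous (Ideal Vertical_Slope) = vector [0, 1, 0]"

lemma norm_vector_3: "norm (vector [a, b, c] :: real ^ 3) = sqrt (a\<^sup>2 + b\<^sup>2 + c\<^sup>2)"
  by (simp add: norm_eq_sqrt_inner inner_vec_def sum_3 vector_3 power2_eq_square)

lemma inner_vector_3: "(vector [a, b, c] :: real ^ 3) \<bullet> v = a * v $ 1 + b * v $ 2 + c * v $ 3"
  by (simp add: inner_vec_def sum_3 vector_3)

lemma scaleR_vector_3: "r *\<^sub>R (vector [a, b, c] :: real ^ 3) = vector [r * a, r * b, r * c]"
  by (simp add: vec_eq_iff forall_3 vector_3)

lemma vector_3_eq_iff:
  "(vector [a, b, c] :: real ^ 3) = vector [a', b', c'] \<longleftrightarrow> a = a' \<and> b = b' \<and> c = c'"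
  by (auto simp: vec_eq_iff forall_3 vector_3)

lemma homogeneous_nonzero: "homogeneous p \<noteq> 0"
  by (cases p rule: homogeneous.cases) (auto simp: vec_eq_iff forall_3 vector_3)

text \<open>For \<open>x\<close> nonzero, \<open>cos (arctan (y / x))\<close> is
  \<open>\<bar>x\<bar> / sqrt (x\<^sup>2 + y\<^sup>2)\<close>; the shift by \<open>pi\<close> when
  \<open>x < 0\<close> restores the sign lost in the absolute value. At the origin the azimuth is
  \<open>pi / 2\<close> by convention, but the radius 0 kills both products.\<close>

lemma azimuth_polar:
  "sqrt (x\<^sup>2 + y\<^sup>2) * cos (azimuth x y) = x" "sqrt (x\<^sup>2 + y\<^sup>2) * sin (azimuth x y) = y"
proof -
  have root: "sqrt (1 + (y / x)\<^sup>2) = sqrt (x\<^sup>2 + y\<^sup>2) / \<bar>x\<bar>" if "x \<noteq> 0"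
  proof -
    have "1 + (y / x)\<^sup>2 = (x\<^sup>2 + y\<^sup>2) / x\<^sup>2"
      using that by (simp add: field_simps)
    then show ?thesis
      by (simp add: real_sqrt_divide)
  qed
  have pos: "sqrt (x\<^sup>2 + y\<^sup>2) > 0" if "x \<noteq> 0"
    using that by (simp add: sum_power2_gt_zero_iff)
  show "sqrt (x\<^sup>2 + y\<^sup>2) * cos (azimuth x y) = x"
    using pos by (auto simp: azimuth_def cos_arctan root simp del: real_sqrt_gt_0_iff)
  show "sqrt (x\<^sup>2 + y\<^sup>2) * sin (azimuth x y) = y"
    using pos by (auto simp: azimuth_def sin_arctan root simp del: real_sqrt_gt_0_iff)
qed

lemma I_PS_eq_scaleR_homogeneous:
  "I_PS \<rho> p = (\<rho> / norm (homogeneous p)) *\<^sub>R homogeneous p"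
proof (cases p rule: homogeneous.cases)
  case (1 x y)
  let ?r = "sqrt (x\<^sup>2 + y\<^sup>2)"
  \<comment> \<open>With \<phi> = \<open>arctan ?r\<close>, sin \<phi> is
    \<open>?r / sqrt (1 + ?r\<^sup>2)\<close>, so the azimuth enters only through the products
    rewritten here.\<close>
  have "\<rho> * (?r * cos (azimuth x y)) / sqrt (1 + ?r\<^sup>2) = \<rho> * x / sqrt (1 + ?r\<^sup>2)"
    "\<rho> * (?r * sin (azimuth x y)) / sqrt (1 + ?r\<^sup>2) = \<rho> * y / sqrt (1 + ?r\<^sup>2)"
    by (simp_all only: azimuth_polar)
  then show ?thesis
    using 1 by (simp add: spherical_def sin_arctan cos_arctan norm_vector_3 scaleR_vector_3
        vector_3_eq_iff ac_simps)
qed (simp_all add: spherical_def sin_arctan cos_arctan norm_vector_3 scaleR_vector_3)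

lemma norm_I_PS: "\<rho> > 0 \<Longrightarrow> norm (I_PS \<rho> p) = \<rho>"
  by (simp add: I_PS_eq_scaleR_homogeneous homogeneous_nonzero)

text \<open>Taking norms forces \<open>c\<close> to be the scaling factor of the radial
  projection.\<close>

lemma I_PS_eqI:
  assumes "s = c *\<^sub>R homogeneous p" "c > 0" "norm s = \<rho>"
  shows "s = I_PS \<rho> p"
proof -
  have "\<rho> / norm (homogeneous p) = c"
    using assms by (auto simp: homogeneous_nonzero)
  then show ?thesis
    using assms(1) by (simp add: I_PS_eq_scaleR_homogeneous)
qed

text \<open>Different kinds of points differ in which coordinates vanish; within one kind, a
  coordinate fixed at 1 forces \<open>c = 1\<close>.\<close>

lemma homogeneous_inj_ray:
  assumes "homogeneous p = c *\<^sub>R homogeneous q" "c > 0"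
  shows "p = q"
  using assms
  by (cases p rule: homogeneous.cases; cases q rule: homogeneous.cases)
    (auto simp: scaleR_vector_3 vector_3_eq_iff)

lemma inj_I_PS:
  assumes "\<rho> > 0"
  shows "inj (I_PS \<rho>)"
proof (rule injI)
  fix p q assume "I_PS \<rho> p = I_PS \<rho> q"
  \<comment> \<open>This factor undoes the projection of \<open>p\<close>, leaving
    \<open>homogeneous p\<close> on the left.\<close>
  then have "(norm (homogeneous p) / \<rho>) *\<^sub>R I_PS \<rho> p = (norm (homogeneous p) / \<rho>) *\<^sub>R I_PS \<rho> q"
    by simp
  then have "homogeneous p = (norm (homogeneous p) / norm (homogeneous q)) *\<^sub>R homogeneous q"
    using assms by (simp add: I_PS_eq_scaleR_homogeneous homogeneous_nonzero)
  then show "p = q"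
    by (rule homogeneous_inj_ray) (simp add: homogeneous_nonzero)
qed

lemma I_PS_in_RP2_S:
  assumes "\<rho> > 0"
  shows "I_PS \<rho> p \<in> RP2_S \<rho>"
proof (cases p rule: homogeneous.cases)
  case (1 x y)
  have "I_PS \<rho> p $ 3 > 0"
    using 1 assms by (simp add: spherical_def vector_3 cos_arctan add_pos_nonneg)
  then show ?thesis
    using norm_I_PS[OF assms] by (simp add: RP2_S_def open_hemisphere_def)
next
  case (2 m)
  have "\<exists>\<theta>\<in>{- pi / 2<..pi / 2}. I_PS \<rho> p = spherical \<rho> \<theta> (pi / 2)"
    using 2 arctan_lbound[of m] arctan_ubound[of m] by (intro bexI[of _ "arctan m"]) auto
  moreover have "I_PS \<rho> p $ 3 = 0"
    using 2 by (simp add: spherical_def vector_3)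
  ultimately show ?thesis
    using norm_I_PS[OF assms] by (simp add: RP2_S_def line_at_infinity_S_def)
next
  case 3
  have "\<exists>\<theta>\<in>{- pi / 2<..pi / 2}. I_PS \<rho> p = spherical \<rho> \<theta> (pi / 2)"
    using 3 by (intro bexI[of _ "pi / 2"]) auto
  moreover have "I_PS \<rho> p $ 3 = 0"
    using 3 by (simp add: spherical_def vector_3)
  ultimately show ?thesis
    using norm_I_PS[OF assms] by (simp add: RP2_S_def line_at_infinity_S_def)
qed

lemma range_I_PS:
  assumes "\<rho> > 0"
  shows "range (I_PS \<rho>) = RP2_S \<rho>"
proof
  show "range (I_PS \<rho>) \<subseteq> RP2_S \<rho>"
    using I_PS_in_RP2_S[OF assms] by blast
  show "RP2_S \<rho> \<subseteq> range (I_PS \<rho>)"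
  proof
    fix s assume "s \<in> RP2_S \<rho>"
    then consider (upper) "norm s = \<rho>" "s $ 3 > 0"
      | (ideal_line) \<theta> where "- pi / 2 < \<theta>" "\<theta> \<le> pi / 2" "s = spherical \<rho> \<theta> (pi / 2)"
      by (auto simp: RP2_S_def open_hemisphere_def line_at_infinity_S_def)
    then show "s \<in> range (I_PS \<rho>)"
    proof cases
      case upper
      \<comment> \<open>The preimage is where the ray through \<open>s\<close> meets the plane of
        height 1.\<close>
      have "s = s $ 3 *\<^sub>R homogeneous (Affine (s $ 1 / s $ 3, s $ 2 / s $ 3))"
        using upper(2) by (simp add: vec_eq_iff forall_3 vector_3)
      from I_PS_eqI[OF this upper(2,1)] show ?thesis
        by blast
    next
      case ideal_line
      show ?thesis
      \<comment> \<open>\<open>tan\<close> inverts \<open>arctan\<close> only on the open interval;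
        the included endpoint is the vertical direction.\<close>
      proof (cases "\<theta> = pi / 2")
        case True
        have "s = I_PS \<rho> (Ideal Vertical_Slope)"
          unfolding ideal_line(3) True by simp
        then show ?thesis
          by blast
      next
        case False
        then have "arctan (tan \<theta>) = \<theta>"
          using ideal_line by (intro arctan_tan) auto
        then have "s = I_PS \<rho> (Ideal (Finite_Slope (tan \<theta>)))"
          using ideal_line by simp
        then show ?thesis
          by blast
      qed
    qed
  qed
qed

text \<open>The normals come from homogenizing the equations to m x - y + b z = 0, x - c z = 0 and z
  = 0; setting z = 0 in the first two leaves exactly the matching ideal point.\<close>

lemma lines_P_orthogonal:
  assumes "l \<in> lines_P"
  obtains n where "n \<noteq> 0" "l = {p. n \<bullet> homogeneous p = 0}"
proof -
  from assms consider (sloped) m b where "l = sloped_line m b"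
    | (vertical) c where "l = vertical_line c" | (ideal_line) "l = line_at_infinity_P"
    by (auto simp: lines_P_def)
  then show thesis
  proof cases
    case sloped
    have "p \<in> l \<longleftrightarrow> vector [m, - 1, b] \<bullet> homogeneous p = 0" for p
      by (cases p rule: homogeneous.cases)
        (auto simp: sloped sloped_line_def inner_vector_3 vector_3)
    then show thesis
      by (intro that[of "vector [m, - 1, b]"]) (auto simp: vec_eq_iff forall_3 vector_3)
  next
    case vertical
    have "p \<in> l \<longleftrightarrow> vector [1, 0, - c] \<bullet> homogeneous p = 0" for p
      by (cases p rule: homogeneous.cases)
        (auto simp: vertical vertical_line_def inner_vector_3 vector_3)
    then show thesis
      by (intro that[of "vector [1, 0, - c]"]) (auto simp: vec_eq_iff forall_3 vector_3)
  next
    case ideal_line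
    have "p \<in> l \<longleftrightarrow> vector [0, 0, 1] \<bullet> homogeneous p = 0" for p
      by (cases p rule: homogeneous.cases)
        (auto simp: ideal_line line_at_infinity_P_def inner_vector_3 vector_3)
    then show thesis
      by (intro that[of "vector [0, 0, 1]"]) (auto simp: vec_eq_iff forall_3 vector_3)
  qed
qed

lemma I_PS_image_line:
  assumes "\<rho> > 0" "l \<in> lines_P"
  shows "I_PS \<rho> ` l \<in> lines_S \<rho>"
proof -
  obtain n where n: "n \<noteq> 0" "l = {p. n \<bullet> homogeneous p = 0}"
    using lines_P_orthogonal[OF assms(2)] .
  have "n \<bullet> I_PS \<rho> p = 0 \<longleftrightarrow> p \<in> l" for p
    using assms(1) n(2) by (simp add: I_PS_eq_scaleR_homogeneous homogeneous_nonzero)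
  \<comment> \<open>By surjectivity every hemisphere point in the plane is the image of some
    \<open>p\<close>, and the equivalence puts that \<open>p\<close> on \<open>l\<close>.\<close>
  then have "I_PS \<rho> ` l = {v. n \<bullet> v = 0} \<inter> RP2_S \<rho>"
    unfolding range_I_PS[OF assms(1), symmetric] by auto
  moreover have "dim {v. n \<bullet> v = 0} = 2"
    using dim_hyperplane[OF n(1)] by simp
  ultimately show ?thesis
    using subspace_hyperplane[of n] by (auto simp: lines_S_def)
qed

lemma RP2_P_eq_UNIV: "RP2_P = UNIV"
  by (auto simp: RP2_P_def line_at_infinity_P_def intro: ext_point.exhaust)

theorem theorem3p4:
  fixes \<rho> :: real
  assumes "\<rho> > 0"
  shows "bij_betw (I_PS \<rho>) RP2_P (RP2_S \<rho>) \<and> (\<forall>l\<in>lines_P. I_PS \<rho> ` l \<in> lines_S \<rho>)"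
  using assms inj_I_PS range_I_PS I_PS_image_line by (simp add: bij_betw_def RP2_P_eq_UNIV)

end
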